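(* If $r\in A$, then $f:S_r(0)\to S_r(0)$ is uniformly locally isometric.
   Context: $p$ is a prime, $a,b\in\mathbb{Q}_p$ with $ab\neq0$, and $\sqrt{a^2-4b}$ is assumed to exist in $\mathbb{Q}_p$. $f(x)=\frac{x^3+ax^2+bx}{ax+b}$ is considered on $\mathbb{Q}_p\setminus\{-\frac{b}{a}\}$. Let $x_1,x_2=\frac{-a\pm\sqrt{a^2-4b}}{2}\in\mathbb{Q}_p$, labelled so that $\alpha:=|x_1|_p\leq\beta:=|x_2|_p$, and $\delta=|a|_p$. (One has $\delta\leq\alpha$ if $\alpha=\beta$, and $\delta=\beta$ if $\alpha<\beta$.) Define $A=\{r:0<r<\alpha\}$ if $\delta\leq\alpha=\beta$, and $A=(0,\beta)\setminus\{\alpha\}$ if $\alpha<\beta=\delta$. $S_r(0)=\{x\in\mathbb{Q}_p:|x|_p=r\}$; for $r\in A$ it is invariant under $f$. For $X\subset\mathbb{Q}_p$ compact open, a map $f:X\to X$ is uniformly locally isometric if there is a constant $\rho>0$ such that for all $c\in X$, $|f(x)-f(y)|_p=|x-y|_p$ whenever $x,y\in X$ with $|x-c|_p\leq\rho$, $|y-c|_p\leq\rho$. *)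

theory Defs
  imports "HOL-Analysis.Analysis" "HOL-Computational_Algebra.Primes"
begin

section \<open>The \<open>p\<close>-adic absolute value on the rationals\<close>

definition padic_abs_rat :: "nat \<Rightarrow> rat \<Rightarrow> real"
  where "padic_abs_rat p q =
    (if q = 0 then 0
     else real p powi (int (multiplicity (int p) (snd (quotient_of q)))
                     - int (multiplicity (int p) (fst (quotient_of q)))))"

context
  fixes p :: nat
  assumes p: "prime p"
begin

private abbreviation (input) N :: "rat \<Rightarrow> real" where "N \<equiv> padic_abs_rat p"

lemma padic_abs_rat_0 [simp]: "N 0 = 0"
  by (simp add: padic_abs_rat_def)

lemma padic_abs_rat_fract:
  assumes "a \<noteq> 0" "b \<noteq> 0"
  shows "N (of_int a / of_int b) =
    real p powi (int (multiplicity (int p) b) - int (multiplicity (int p) a))"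
proof -
  define q :: rat where "q = of_int a / of_int b"
  obtain m n where mn: "quotient_of q = (m, n)" by fastforce
  have n: "n > 0" using quotient_of_denom_pos[OF mn] .
  have q: "q = of_int m / of_int n" using quotient_of_div[OF mn] .
  have q0: "q \<noteq> 0" using assms by (simp add: q_def)
  have m: "m \<noteq> 0" using q q0 by auto
  have "of_int a * of_int n = (of_int m * of_int b :: rat)"
    using q n assms by (simp add: q_def field_simps)
  then have eq: "a * n = m * b" by (metis of_int_eq_iff of_int_mult)
  have pe: "prime_elem (int p)" using p by simp
  have "multiplicity (int p) a + multiplicity (int p) n
      = multiplicity (int p) m + multiplicity (int p) b"
    using arg_cong[OF eq, of "multiplicity (int p)"] pe assms m n
    by (simp add: prime_elem_multiplicity_mult_distrib)
  then have "int (multiplicity (int p) n) - int (multiplicity (int p) m)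
    = int (multiplicity (int p) b) - int (multiplicity (int p) a)" by linarith
  then show ?thesis
    using q0 mn by (simp add: padic_abs_rat_def flip: q_def)
qed

lemma rat_fractE:
  fixes q :: rat
  assumes "q \<noteq> 0"
  obtains a b where "a \<noteq> 0" "b \<noteq> 0" "q = of_int a / of_int b"
proof -
  obtain m n where mn: "quotient_of q = (m, n)" by fastforce
  show ?thesis
    using that[of m n] quotient_of_denom_pos[OF mn] quotient_of_div[OF mn] assms by auto
qed

lemma padic_abs_rat_pos: "q \<noteq> 0 \<Longrightarrow> N q > 0"
  using p prime_gt_0_nat[OF p] by (simp add: padic_abs_rat_def)

lemma padic_abs_rat_eq_0_iff [simp]: "N q = 0 \<longleftrightarrow> q = 0"
  using padic_abs_rat_pos[of q] by (cases "q = 0") auto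

lemma padic_abs_rat_nonneg [simp]: "N q \<ge> 0"
  using padic_abs_rat_pos[of q] by (cases "q = 0") auto

lemma padic_abs_rat_mult: "N (x * y) = N x * N y"
proof (cases "x = 0 \<or> y = 0")
  case False
  then have "x \<noteq> 0" "y \<noteq> 0" by auto
  obtain a b where x: "a \<noteq> 0" "b \<noteq> 0" "x = of_int a / of_int b"
    using rat_fractE[OF \<open>x \<noteq> 0\<close>] .
  obtain c d where y: "c \<noteq> 0" "d \<noteq> 0" "y = of_int c / of_int d"
    using rat_fractE[OF \<open>y \<noteq> 0\<close>] .
  have xy: "x * y = of_int (a * c) / of_int (b * d)" using x y by simp
  have pe: "prime_elem (int p)" using p by simp
  have "real p \<noteq> 0" using prime_gt_0_nat[OF p] by simp
  then show ?thesis
    unfolding xy using x y pe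
    by (simp add: padic_abs_rat_fract prime_elem_multiplicity_mult_distrib
        power_int_add[symmetric] algebra_simps del: of_int_mult)
qed auto

lemma padic_abs_rat_1 [simp]: "N 1 = 1"
  using padic_abs_rat_fract[of 1 1] by simp

lemma padic_abs_rat_minus [simp]: "N (- x) = N x"
proof -
  have "N (-1) * N (-1) = 1" using padic_abs_rat_mult[of "-1" "-1"] by simp
  then have "N (-1) = 1"
    using padic_abs_rat_nonneg[of "-1"]
    by (metis abs_of_nonneg abs_square_eq_1 power2_eq_square)
  then show ?thesis using padic_abs_rat_mult[of "-1" x] by simp
qed

lemma padic_abs_rat_minus_commute: "N (x - y) = N (y - x)"
  using padic_abs_rat_minus[of "x - y"] by simp

lemma padic_abs_rat_inverse: "N (inverse x) = inverse (N x)"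
proof (cases "x = 0")
  case False
  then have "N (inverse x) * N x = 1" by (simp flip: padic_abs_rat_mult)
  then show ?thesis by (metis inverse_unique mult.commute)
qed auto

lemma padic_abs_rat_add_le_max: "N (x + y) \<le> max (N x) (N y)"
proof (cases "x = 0 \<or> y = 0 \<or> x + y = 0")
  case True
  then show ?thesis by (auto simp: le_max_iff_disj)
next
  case False
  then have "x \<noteq> 0" "y \<noteq> 0" by auto
  obtain a b where x: "a \<noteq> 0" "b \<noteq> 0" "x = of_int a / of_int b"
    using rat_fractE[OF \<open>x \<noteq> 0\<close>] .
  obtain c d where y: "c \<noteq> 0" "d \<noteq> 0" "y = of_int c / of_int d"
    using rat_fractE[OF \<open>y \<noteq> 0\<close>] .
  define u v w where "u = a * d" and "v = c * b" and "w = b * d"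
  have nz: "u \<noteq> 0" "v \<noteq> 0" "w \<noteq> 0" using x y by (auto simp: u_def v_def w_def)
  have xe: "x = of_int u / of_int w" and ye: "y = of_int v / of_int w"
    using x y by (auto simp: u_def v_def w_def)
  have s: "x + y = of_int (u + v) / of_int w"
    by (simp add: xe ye add_divide_distrib)
  then have uv: "u + v \<noteq> 0" using False by auto
  have p1: "\<not> is_unit (int p)" using p not_prime_unit[of "int p"] by auto
  let ?m = "\<lambda>z. multiplicity (int p) z"
  have "int p ^ min (?m u) (?m v) dvd u + v"
    by (intro dvd_add multiplicity_dvd') auto
  then have "min (?m u) (?m v) \<le> ?m (u + v)"
    using uv p1 by (intro multiplicity_geI) auto
  then consider "?m u \<le> ?m (u + v)" | "?m v \<le> ?m (u + v)"
    by (auto simp: min_le_iff_disj)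
  then show ?thesis
  proof cases
    case 1
    then have "N (x + y) \<le> N x" unfolding s unfolding xe
      using nz uv prime_ge_1_nat[OF p]
      by (simp add: padic_abs_rat_fract power_int_increasing del: of_int_add)
    then show ?thesis by simp
  next
    case 2
    then have "N (x + y) \<le> N y" unfolding s unfolding ye
      using nz uv prime_ge_1_nat[OF p]
      by (simp add: padic_abs_rat_fract power_int_increasing del: of_int_add)
    then show ?thesis by simp
  qed
qed

lemma padic_abs_rat_add_le: "N (x + y) \<le> N x + N y"
  using padic_abs_rat_add_le_max[of x y] padic_abs_rat_nonneg[of x] padic_abs_rat_nonneg[of y]
  by linarith

lemma padic_abs_rat_diff_ge: "\<bar>N x - N y\<bar> \<le> N (x - y)"
  using padic_abs_rat_add_le[of "x - y" y] padic_abs_rat_add_le[of "y - x" x]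
    padic_abs_rat_minus_commute[of x y]
  by (simp add: abs_le_iff)

end


section \<open>Cauchy and null sequences for the \<open>p\<close>-adic absolute value\<close>

definition padic_Cauchy :: "nat \<Rightarrow> (nat \<Rightarrow> rat) \<Rightarrow> bool"
  where "padic_Cauchy p X \<longleftrightarrow>
    (\<forall>e>0. \<exists>k. \<forall>m\<ge>k. \<forall>n\<ge>k. padic_abs_rat p (X m - X n) < e)"

definition padic_null :: "nat \<Rightarrow> (nat \<Rightarrow> rat) \<Rightarrow> bool"
  where "padic_null p X \<longleftrightarrow> (\<lambda>n. padic_abs_rat p (X n)) \<longlonglongrightarrow> 0"

lemma padic_CauchyD:
  "padic_Cauchy p X \<Longrightarrow> e > 0 \<Longrightarrow> \<exists>k. \<forall>m\<ge>k. \<forall>n\<ge>k. padic_abs_rat p (X m - X n) < e"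
  by (simp add: padic_Cauchy_def)

context
  fixes p :: nat
  assumes p: "prime p"
begin

private abbreviation (input) abs\<^sub>p :: "rat \<Rightarrow> real" where "abs\<^sub>p \<equiv> padic_abs_rat p"

lemma padic_Cauchy_const [simp]: "padic_Cauchy p (\<lambda>n. x)"
  by (auto simp: padic_Cauchy_def p)

lemma padic_null_0 [simp]: "padic_null p (\<lambda>n. 0)"
  by (simp add: padic_null_def p)

lemma padic_null_bound:
  assumes "Y \<longlonglongrightarrow> 0" "\<And>n. abs\<^sub>p (X n) \<le> Y n"
  shows "padic_null p X"
  unfolding padic_null_def
  by (rule tendsto_sandwich[OF _ _ tendsto_const assms(1)]) (auto simp: p assms(2))

lemma padic_null_add:
  assumes "padic_null p X" "padic_null p Y"
  shows "padic_null p (\<lambda>n. X n + Y n)"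
proof (rule padic_null_bound)
  show "(\<lambda>n. abs\<^sub>p (X n) + abs\<^sub>p (Y n)) \<longlonglongrightarrow> 0"
    using tendsto_add[OF assms[unfolded padic_null_def]] by simp
qed (rule padic_abs_rat_add_le[OF p])

lemma padic_null_minus: "padic_null p X \<Longrightarrow> padic_null p (\<lambda>n. - X n)"
  by (simp add: padic_null_def p)

lemma padic_Cauchy_add:
  assumes "padic_Cauchy p X" "padic_Cauchy p Y"
  shows "padic_Cauchy p (\<lambda>n. X n + Y n)"
  unfolding padic_Cauchy_def
proof (intro allI impI)
  fix e :: real assume e: "e > 0"
  obtain i where i: "\<forall>m\<ge>i. \<forall>n\<ge>i. abs\<^sub>p (X m - X n) < e" using padic_CauchyD[OF assms(1) e] ..
  obtain j where j: "\<forall>m\<ge>j. \<forall>n\<ge>j. abs\<^sub>p (Y m - Y n) < e" using padic_CauchyD[OF assms(2) e] ..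
  have "abs\<^sub>p (X m + Y m - (X n + Y n)) < e" if "m \<ge> max i j" "n \<ge> max i j" for m n
  proof -
    have "abs\<^sub>p (X m + Y m - (X n + Y n)) \<le> max (abs\<^sub>p (X m - X n)) (abs\<^sub>p (Y m - Y n))"
      using padic_abs_rat_add_le_max[OF p, of "X m - X n" "Y m - Y n"]
      by (simp add: algebra_simps)
    also have "\<dots> < e" using i j that by simp
    finally show ?thesis .
  qed
  then show "\<exists>k. \<forall>m\<ge>k. \<forall>n\<ge>k. abs\<^sub>p (X m + Y m - (X n + Y n)) < e" by blast
qed

lemma padic_Cauchy_minus: "padic_Cauchy p X \<Longrightarrow> padic_Cauchy p (\<lambda>n. - X n)"
proof -
  have "abs\<^sub>p (- x - - y) = abs\<^sub>p (x - y)" for x y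
    using padic_abs_rat_minus_commute[OF p, of x y] by simp
  then show "padic_Cauchy p X \<Longrightarrow> padic_Cauchy p (\<lambda>n. - X n)"
    by (simp only: padic_Cauchy_def)
qed

lemma padic_Cauchy_abs_convergent:
  assumes "padic_Cauchy p X"
  shows "convergent (\<lambda>n. abs\<^sub>p (X n))"
proof -
  have "Cauchy (\<lambda>n. abs\<^sub>p (X n))"
    unfolding Cauchy_def dist_real_def
    using padic_CauchyD[OF assms] padic_abs_rat_diff_ge[OF p] by (meson le_less_trans)
  then show ?thesis by (rule Cauchy_convergent)
qed

lemma padic_Cauchy_abs_tendsto:
  assumes "padic_Cauchy p X"
  shows "(\<lambda>n. abs\<^sub>p (X n)) \<longlonglongrightarrow> lim (\<lambda>n. abs\<^sub>p (X n))"
  using padic_Cauchy_abs_convergent[OF assms] by (simp add: convergent_LIMSEQ_iff)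

lemma padic_Cauchy_bounded:
  assumes "padic_Cauchy p X"
  obtains B where "B > 0" "\<And>n. abs\<^sub>p (X n) \<le> B"
  using convergent_imp_Bseq[OF padic_Cauchy_abs_convergent[OF assms]] padic_abs_rat_nonneg[OF p]
  by (auto simp: Bseq_def)

lemma padic_Cauchy_mult:
  assumes X: "padic_Cauchy p X" and Y: "padic_Cauchy p Y"
  shows "padic_Cauchy p (\<lambda>n. X n * Y n)"
  unfolding padic_Cauchy_def
proof (intro allI impI)
  fix e :: real assume e: "e > 0"
  obtain B where B: "B > 0" "\<And>n. abs\<^sub>p (X n) \<le> B" using padic_Cauchy_bounded[OF X] by blast
  obtain C where C: "C > 0" "\<And>n. abs\<^sub>p (Y n) \<le> C" using padic_Cauchy_bounded[OF Y] by blast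
  have "e / C > 0" "e / B > 0" using e B C by auto
  obtain i where i: "\<forall>m\<ge>i. \<forall>n\<ge>i. abs\<^sub>p (X m - X n) < e / C"
    using padic_CauchyD[OF X \<open>e / C > 0\<close>] ..
  obtain j where j: "\<forall>m\<ge>j. \<forall>n\<ge>j. abs\<^sub>p (Y m - Y n) < e / B"
    using padic_CauchyD[OF Y \<open>e / B > 0\<close>] ..
  have "abs\<^sub>p (X m * Y m - X n * Y n) < e" if "m \<ge> max i j" "n \<ge> max i j" for m n
  proof -
    have "abs\<^sub>p (X m * Y m - X n * Y n) = abs\<^sub>p (X m * (Y m - Y n) + (X m - X n) * Y n)"
      by (simp add: algebra_simps)
    also have "\<dots> \<le> max (abs\<^sub>p (X m) * abs\<^sub>p (Y m - Y n)) (abs\<^sub>p (X m - X n) * abs\<^sub>p (Y n))"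
      using padic_abs_rat_add_le_max[OF p] by (simp add: padic_abs_rat_mult[OF p, symmetric])
    also have "\<dots> \<le> max (B * abs\<^sub>p (Y m - Y n)) (abs\<^sub>p (X m - X n) * C)"
      using B C by (intro max.mono mult_mono) (simp_all add: p)
    also have "\<dots> < e"
    proof (rule max_less_iff_conj[THEN iffD2], rule conjI)
      show "B * abs\<^sub>p (Y m - Y n) < e"
        using j that B(1) by (simp add: pos_less_divide_eq mult.commute)
      show "abs\<^sub>p (X m - X n) * C < e"
        using i that C(1) by (simp add: pos_less_divide_eq)
    qed
    finally show ?thesis .
  qed
  then show "\<exists>k. \<forall>m\<ge>k. \<forall>n\<ge>k. abs\<^sub>p (X m * Y m - X n * Y n) < e" by blast
qed

lemma padic_null_mult:
  assumes "padic_Cauchy p X" "padic_null p Y"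
  shows "padic_null p (\<lambda>n. X n * Y n)"
  using tendsto_mult[OF padic_Cauchy_abs_tendsto[OF assms(1)] assms(2)[unfolded padic_null_def]]
  by (simp add: padic_null_def padic_abs_rat_mult[OF p])

lemma padic_abs_lim_eq:
  assumes "padic_Cauchy p X" "padic_Cauchy p Y" "padic_null p (\<lambda>n. X n - Y n)"
  shows "lim (\<lambda>n. abs\<^sub>p (X n)) = lim (\<lambda>n. abs\<^sub>p (Y n))"
proof -
  have "(\<lambda>n. abs\<^sub>p (X n) - abs\<^sub>p (Y n)) \<longlonglongrightarrow> 0"
  proof (rule Lim_null_comparison)
    show "(\<lambda>n. abs\<^sub>p (X n - Y n)) \<longlonglongrightarrow> 0"
      using assms(3) by (simp add: padic_null_def)
    show "\<forall>\<^sub>F n in sequentially. norm (abs\<^sub>p (X n) - abs\<^sub>p (Y n)) \<le> abs\<^sub>p (X n - Y n)"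
      by (simp add: padic_abs_rat_diff_ge[OF p])
  qed
  moreover have "(\<lambda>n. abs\<^sub>p (X n) - abs\<^sub>p (Y n)) \<longlonglongrightarrow> lim (\<lambda>n. abs\<^sub>p (X n)) - lim (\<lambda>n. abs\<^sub>p (Y n))"
    by (intro tendsto_diff padic_Cauchy_abs_tendsto assms)
  ultimately show ?thesis using LIMSEQ_unique by fastforce
qed

lemma padic_null_cong:
  assumes "padic_null p (\<lambda>n. X n - Y n)"
  shows "padic_null p X \<longleftrightarrow> padic_null p Y"
  using padic_null_add[OF assms, of Y] padic_null_add[OF padic_null_minus[OF assms], of X]
  by auto

lemma padic_not_null:
  assumes "padic_Cauchy p X" "\<not> padic_null p X"
  shows "lim (\<lambda>n. abs\<^sub>p (X n)) > 0" "\<forall>\<^sub>F n in sequentially. abs\<^sub>p (X n) > lim (\<lambda>n. abs\<^sub>p (X n)) / 2"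
    "\<forall>\<^sub>F n in sequentially. X n \<noteq> 0"
proof -
  let ?L = "lim (\<lambda>n. abs\<^sub>p (X n))"
  note L = padic_Cauchy_abs_tendsto[OF assms(1)]
  have "?L \<noteq> 0" using L assms(2) by (auto simp: padic_null_def)
  moreover have "?L \<ge> 0" by (rule tendsto_lowerbound[OF L]) (auto simp: p)
  ultimately show L0: "?L > 0" by simp
  then show ev: "\<forall>\<^sub>F n in sequentially. abs\<^sub>p (X n) > ?L / 2"
    using order_tendstoD(1)[OF L, of "?L / 2"] by simp
  then show "\<forall>\<^sub>F n in sequentially. X n \<noteq> 0"
    by eventually_elim (use L0 p in auto)
qed

lemma padic_abs_rat_inverse_diff:
  assumes "x \<noteq> 0" "y \<noteq> 0"
  shows "abs\<^sub>p (inverse x - inverse y) = abs\<^sub>p (x - y) / (abs\<^sub>p x * abs\<^sub>p y)"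
proof -
  have "inverse x - inverse y = (y - x) * (inverse x * inverse y)"
    using assms by (simp add: field_simps)
  also have "abs\<^sub>p \<dots> = abs\<^sub>p (x - y) * (inverse (abs\<^sub>p x) * inverse (abs\<^sub>p y))"
    by (simp only: padic_abs_rat_mult[OF p] padic_abs_rat_inverse[OF p]
        padic_abs_rat_minus_commute[OF p, of y x])
  finally show ?thesis by (simp add: divide_inverse)
qed

lemma padic_Cauchy_inverse:
  assumes X: "padic_Cauchy p X" and nz: "\<not> padic_null p X"
  shows "padic_Cauchy p (\<lambda>n. inverse (X n))"
  unfolding padic_Cauchy_def
proof (intro allI impI)
  fix e :: real assume e: "e > 0"
  define b where "b = lim (\<lambda>n. abs\<^sub>p (X n)) / 2"
  have b: "b > 0" using padic_not_null(1)[OF X nz] by (simp add: b_def)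
  obtain i where i: "\<forall>n\<ge>i. abs\<^sub>p (X n) > b"
    using padic_not_null(2)[OF X nz] by (auto simp: b_def eventually_sequentially)
  obtain j where j: "\<forall>m\<ge>j. \<forall>n\<ge>j. abs\<^sub>p (X m - X n) < e * (b * b)"
    using padic_CauchyD[OF X, of "e * (b * b)"] e b by auto
  have "abs\<^sub>p (inverse (X m) - inverse (X n)) < e" if mn: "m \<ge> max i j" "n \<ge> max i j" for m n
  proof -
    have bm: "b < abs\<^sub>p (X m)" "b < abs\<^sub>p (X n)" using i mn by auto
    then have "X m \<noteq> 0" "X n \<noteq> 0" using b p by auto
    then have "abs\<^sub>p (inverse (X m) - inverse (X n)) = abs\<^sub>p (X m - X n) / (abs\<^sub>p (X m) * abs\<^sub>p (X n))"
      by (rule padic_abs_rat_inverse_diff)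
    also have "\<dots> \<le> abs\<^sub>p (X m - X n) / (b * b)"
      using b bm p by (intro divide_left_mono mult_mono mult_pos_pos) auto
    also have "\<dots> < e" using j mn b by (simp add: divide_less_eq)
    finally show ?thesis .
  qed
  then show "\<exists>k. \<forall>m\<ge>k. \<forall>n\<ge>k. abs\<^sub>p (inverse (X m) - inverse (X n)) < e" by blast
qed

lemma padic_null_inverse_diff:
  assumes X: "padic_Cauchy p X" "\<not> padic_null p X"
    and Y: "padic_Cauchy p Y" "\<not> padic_null p Y"
    and XY: "padic_null p (\<lambda>n. X n - Y n)"
  shows "padic_null p (\<lambda>n. inverse (X n) - inverse (Y n))"
proof -
  have "(\<lambda>n. abs\<^sub>p (X n - Y n) / (abs\<^sub>p (X n) * abs\<^sub>p (Y n))) \<longlonglongrightarrow>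
      0 / (lim (\<lambda>n. abs\<^sub>p (X n)) * lim (\<lambda>n. abs\<^sub>p (Y n)))"
    using padic_not_null(1)[OF X] padic_not_null(1)[OF Y] XY
    by (intro tendsto_divide tendsto_mult padic_Cauchy_abs_tendsto X Y)
       (auto simp: padic_null_def)
  moreover have "\<forall>\<^sub>F n in sequentially.
      abs\<^sub>p (X n - Y n) / (abs\<^sub>p (X n) * abs\<^sub>p (Y n)) = abs\<^sub>p (inverse (X n) - inverse (Y n))"
    using padic_not_null(3)[OF X] padic_not_null(3)[OF Y]
    by eventually_elim (simp add: padic_abs_rat_inverse_diff)
  ultimately show ?thesis
    unfolding padic_null_def using Lim_transform_eventually by fastforce
qed

lemma padic_null_inverse_mult:
  assumes X: "padic_Cauchy p X" "\<not> padic_null p X"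
  shows "padic_null p (\<lambda>n. inverse (X n) * X n - 1)"
  unfolding padic_null_def
proof (rule tendsto_eventually)
  show "\<forall>\<^sub>F n in sequentially. abs\<^sub>p (inverse (X n) * X n - 1) = 0"
    using padic_not_null(3)[OF X] by eventually_elim (simp add: p)
qed

end


section \<open>The field of \<open>p\<close>-adic numbers\<close>

text \<open>
  The prime is a parameter of the type of \<open>p\<close>-adic numbers: it is the cardinality of a
  type of class \<open>prime_card\<close>.
\<close>

class prime_card =
  assumes prime_card: "prime (CARD('a))"

instance bool :: prime_card
  by standard simp

definition padic_rel :: "'p::prime_card itself \<Rightarrow> (nat \<Rightarrow> rat) \<Rightarrow> (nat \<Rightarrow> rat) \<Rightarrow> bool"
  where "padic_rel _ X Y \<longleftrightarrow>
    padic_Cauchy CARD('p) X \<and> padic_Cauchy CARD('p) Y \<and> padic_null CARD('p) (\<lambda>n. X n - Y n)"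

lemma part_equivp_padic_rel: "part_equivp (padic_rel TYPE('p::prime_card))"
proof (rule part_equivpI)
  note p = prime_card[where 'a = 'p]
  show "\<exists>X. padic_rel TYPE('p) X X"
    by (rule exI[of _ "\<lambda>n. 0"]) (simp add: padic_rel_def p)
  show "symp (padic_rel TYPE('p))"
    by (rule sympI) (simp add: padic_rel_def padic_null_def padic_abs_rat_minus_commute[OF p])
  show "transp (padic_rel TYPE('p))"
  proof (rule transpI)
    fix X Y Z
    assume *: "padic_rel TYPE('p) X Y" "padic_rel TYPE('p) Y Z"
    then have "padic_null CARD('p) (\<lambda>n. (X n - Y n) + (Y n - Z n))"
      unfolding padic_rel_def by (intro padic_null_add[OF p]) simp_all
    with * show "padic_rel TYPE('p) X Z"
      by (simp add: padic_rel_def)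
  qed
qed

text \<open>
  The type is the set of equivalence classes of Cauchy sequences. The \<^emph>\<open>quotient_type\<close> command
  does not support the phantom type parameter, hence the explicit construction.
\<close>

typedef ('p::prime_card) padic =
  "{C. \<exists>X. padic_rel TYPE('p) X X \<and> C = Collect (padic_rel TYPE('p) X)}"
  morphisms padic_class Abs_padic
proof -
  obtain X where "padic_rel TYPE('p) X X"
    using part_equivp_padic_rel by (auto elim: part_equivpE)
  then show ?thesis by blast
qed

definition Padic :: "(nat \<Rightarrow> rat) \<Rightarrow> 'p::prime_card padic"
  where "Padic X = Abs_padic (Collect (padic_rel TYPE('p) X))"

definition rep_padic :: "'p::prime_card padic \<Rightarrow> nat \<Rightarrow> rat"
  where "rep_padic x = (SOME X. X \<in> padic_class x)"

definition cr_padic :: "(nat \<Rightarrow> rat) \<Rightarrow> 'p::prime_card padic \<Rightarrow> bool"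
  where "cr_padic = (\<lambda>X x. padic_rel TYPE('p) X X \<and> Padic X = x)"

lemma Quotient_padic:
  "Quotient (padic_rel TYPE('p::prime_card)) (Padic :: _ \<Rightarrow> 'p padic) rep_padic cr_padic"
proof -
  interpret Q: quot_type "padic_rel TYPE('p)" "Abs_padic :: _ \<Rightarrow> 'p padic" padic_class
  proof
    show "part_equivp (padic_rel TYPE('p))" by (rule part_equivp_padic_rel)
    show "\<exists>X. padic_rel TYPE('p) X X \<and> padic_class y = Collect (padic_rel TYPE('p) X)"
      for y :: "'p padic"
      using padic_class[of y] by (rule CollectD)
    show "Abs_padic (padic_class y) = y" for y :: "'p padic" by (rule padic_class_inverse)
    show "padic_class (Abs_padic C :: 'p padic) = C"
      if "\<exists>X. padic_rel TYPE('p) X X \<and> C = Collect (padic_rel TYPE('p) X)" for C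
      using that by (intro Abs_padic_inverse CollectI)
    show "padic_class x = padic_class y \<longleftrightarrow> x = y" for x y :: "'p padic"
      by (rule padic_class_inject)
  qed
  have "Q.abs = Padic" "Q.rep = rep_padic"
    by (rule ext, simp only: Q.abs_def Padic_def) (rule ext, simp only: Q.rep_def rep_padic_def)
  then have "Quotient3 (padic_rel TYPE('p)) (Padic :: _ \<Rightarrow> 'p padic) rep_padic"
    using Q.Quotient by (simp only:)
  then show ?thesis
    by (rule Quotient3_to_Quotient) (simp only: cr_padic_def atomize_eq)
qed

setup_lifting Quotient_padic

instantiation padic :: (prime_card) field
begin

lift_definition zero_padic :: "'a padic" is "\<lambda>n. 0"
  by (simp add: padic_rel_def prime_card)

lift_definition one_padic :: "'a padic" is "\<lambda>n. 1"
  by (simp add: padic_rel_def prime_card)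

lift_definition plus_padic :: "'a padic \<Rightarrow> 'a padic \<Rightarrow> 'a padic" is "\<lambda>X Y n. X n + Y n"
  unfolding padic_rel_def add_diff_add
  by (simp add: padic_Cauchy_add padic_null_add prime_card)

lift_definition uminus_padic :: "'a padic \<Rightarrow> 'a padic" is "\<lambda>X n. - X n"
  unfolding padic_rel_def minus_diff_minus
  by (simp add: padic_Cauchy_minus padic_null_minus prime_card del: minus_diff_eq)

lift_definition times_padic :: "'a padic \<Rightarrow> 'a padic \<Rightarrow> 'a padic" is "\<lambda>X Y n. X n * Y n"
proof -
  fix X X' Y Y' :: "nat \<Rightarrow> rat"
  assume *: "padic_rel TYPE('a) X X'" "padic_rel TYPE('a) Y Y'"
  note p = prime_card[where 'a = 'a]
  have "padic_null CARD('a) (\<lambda>n. X n * (Y n - Y' n) + Y' n * (X n - X' n))"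
    using * unfolding padic_rel_def
    by (intro padic_null_add[OF p] padic_null_mult[OF p]) auto
  then show "padic_rel TYPE('a) (\<lambda>n. X n * Y n) (\<lambda>n. X' n * Y' n)"
    using * unfolding padic_rel_def by (simp add: padic_Cauchy_mult[OF p] algebra_simps)
qed

text \<open>The case distinction ensures \<open>inverse 0 = 0\<close>, as required by class \<open>field\<close>.\<close>

lift_definition inverse_padic :: "'a padic \<Rightarrow> 'a padic"
  is "\<lambda>X. if padic_null CARD('a) X then (\<lambda>n. 0) else (\<lambda>n. inverse (X n))"
proof -
  fix X Y :: "nat \<Rightarrow> rat"
  note p = prime_card[where 'a = 'a]
  assume "padic_rel TYPE('a) X Y"
  then have X: "padic_Cauchy CARD('a) X" and Y: "padic_Cauchy CARD('a) Y"
    and XY: "padic_null CARD('a) (\<lambda>n. X n - Y n)"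
    by (simp_all add: padic_rel_def)
  show "?thesis X Y"
    using padic_null_cong[OF p XY]
    by (simp add: X Y XY padic_rel_def p padic_Cauchy_inverse padic_null_inverse_diff)
qed

definition minus_padic :: "'a padic \<Rightarrow> 'a padic \<Rightarrow> 'a padic"
  where "minus_padic x y = x + - y"

definition divide_padic :: "'a padic \<Rightarrow> 'a padic \<Rightarrow> 'a padic"
  where "divide_padic x y = x * inverse y"

instance
proof
  note p = prime_card[where 'a = 'a]
  note [simp] = padic_rel_def p padic_Cauchy_add padic_Cauchy_mult padic_Cauchy_minus
    padic_Cauchy_inverse
  fix a b c :: "'a padic"
  show "a + b = b + a"
    by transfer (simp add: ac_simps)
  show "(a + b) + c = a + (b + c)"
    by transfer (simp add: ac_simps)
  show "0 + a = a"
    by transfer simp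
  show "- a + a = 0"
    by transfer simp
  show "a - b = a + - b"
    by (rule minus_padic_def)
  show "(a * b) * c = a * (b * c)"
    by transfer (simp add: ac_simps)
  show "a * b = b * a"
    by transfer (simp add: ac_simps)
  show "1 * a = a"
    by transfer simp
  show "(a + b) * c = a * c + b * c"
    by transfer (simp add: distrib_right)
  show "(0::'a padic) \<noteq> 1"
    by transfer (simp add: padic_null_def LIMSEQ_const_iff)
  show "a \<noteq> 0 \<Longrightarrow> inverse a * a = 1"
    by transfer (simp add: padic_null_inverse_mult)
  show "a div b = a * inverse b"
    by (rule divide_padic_def)
  show "inverse (0::'a padic) = 0"
    by transfer simp
qed

end


section \<open>Absolute value and topology\<close>

lift_definition padic_abs :: "'p::prime_card padic \<Rightarrow> real"
  is "\<lambda>X. lim (\<lambda>n. padic_abs_rat CARD('p) (X n))"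
  unfolding padic_rel_def by (rule padic_abs_lim_eq[OF prime_card]) auto

lemma padic_abs_eq_0_iff [simp]: "padic_abs x = 0 \<longleftrightarrow> x = 0"
proof (transfer, goal_cases)
  case (1 X)
  note p = prime_card[where 'a = 'a]
  have X: "padic_Cauchy CARD('a) X" using 1 by (simp add: padic_rel_def)
  have "padic_null CARD('a) X \<longleftrightarrow> lim (\<lambda>n. padic_abs_rat CARD('a) (X n)) = 0"
    using padic_not_null(1)[OF p X] limI[of "\<lambda>n. padic_abs_rat CARD('a) (X n)" 0]
    by (cases "padic_null CARD('a) X") (auto simp: padic_null_def)
  with X show ?case by (simp add: padic_rel_def p)
qed

lemma padic_abs_0 [simp]: "padic_abs 0 = 0"
  by simp

lemma padic_abs_nonneg [simp]: "padic_abs (x :: 'p::prime_card padic) \<ge> 0"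
proof (transfer, goal_cases)
  case (1 X)
  note p = prime_card[where 'a = 'p]
  have "padic_Cauchy CARD('p) X" using 1 by (simp add: padic_rel_def)
  from tendsto_lowerbound[OF padic_Cauchy_abs_tendsto[OF p this]] show ?case by (auto simp: p)
qed

lemma padic_abs_1 [simp]: "padic_abs 1 = 1"
  by transfer (simp add: prime_card)

lemma padic_abs_mult: "padic_abs (x * y :: 'p::prime_card padic) = padic_abs x * padic_abs y"
proof (transfer, goal_cases)
  case (1 X Y)
  note p = prime_card[where 'a = 'p]
  have "padic_Cauchy CARD('p) X" "padic_Cauchy CARD('p) Y" using 1 by (auto simp: padic_rel_def)
  then show ?case
    by (intro limI) (simp add: padic_abs_rat_mult[OF p] tendsto_mult padic_Cauchy_abs_tendsto[OF p])
qed

lemma padic_abs_minus [simp]: "padic_abs (- x :: 'p::prime_card padic) = padic_abs x"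
  by transfer (simp add: prime_card)

lemma padic_abs_minus_commute: "padic_abs (x - y :: 'p::prime_card padic) = padic_abs (y - x)"
  using padic_abs_minus[of "x - y"] by simp

lemma padic_abs_add_le_max:
  "padic_abs (x + y :: 'p::prime_card padic) \<le> max (padic_abs x) (padic_abs y)"
proof (transfer, goal_cases)
  case (1 X Y)
  note p = prime_card[where 'a = 'p]
  have XY: "padic_Cauchy CARD('p) X" "padic_Cauchy CARD('p) Y"
    using 1 by (auto simp: padic_rel_def)
  show ?case
    by (rule tendsto_le[OF _ tendsto_max padic_Cauchy_abs_tendsto[OF p]])
       (auto intro!: padic_Cauchy_abs_tendsto[OF p] padic_Cauchy_add[OF p] XY
          padic_abs_rat_add_le_max[OF p] always_eventually)
qed

lemma of_nat_padic: "(of_nat n :: 'p::prime_card padic) = Padic (\<lambda>_. of_nat n)"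
proof (induction n)
  case 0
  show ?case by (simp add: zero_padic_def)
next
  case (Suc n)
  note p = prime_card[where 'a = 'p]
  have "Padic (\<lambda>_. of_nat n) + 1 = (Padic (\<lambda>_. of_nat (Suc n)) :: 'p padic)"
    unfolding one_padic_def
    by (subst plus_padic.abs_eq) (simp_all add: padic_rel_def p add.commute)
  with Suc show ?case by (simp add: add.commute)
qed

lemma padic_abs_of_nat:
  "padic_abs (of_nat n :: 'p::prime_card padic) = padic_abs_rat CARD('p) (of_nat n)"
  by (simp add: of_nat_padic padic_abs.abs_eq padic_rel_def prime_card)

instance padic :: (prime_card) field_char_0
proof
  show "inj (of_nat :: nat \<Rightarrow> 'a padic)"
  proof (rule linorder_injI)
    fix m n :: nat
    assume "m < n"
    then have "padic_abs (of_nat (n - m) :: 'a padic) \<noteq> 0"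
      unfolding padic_abs_of_nat by (simp add: prime_card del: of_nat_diff)
    moreover have "(of_nat n :: 'a padic) = of_nat (n - m) + of_nat m"
      using \<open>m < n\<close> by (simp flip: of_nat_add)
    ultimately show "(of_nat m :: 'a padic) \<noteq> of_nat n"
      by auto
  qed
qed

lemma padic_abs_of_rat:
  "padic_abs (of_rat q :: 'p::prime_card padic) = padic_abs_rat CARD('p) q"
proof -
  note p = prime_card[where 'a = 'p]
  have int: "padic_abs (of_int k :: 'p padic) = padic_abs_rat CARD('p) (of_int k)" for k
    by (cases k rule: int_cases2) (simp_all add: padic_abs_of_nat p)
  obtain m n where mn: "quotient_of q = (m, n)" by fastforce
  have n: "n > 0" and q: "q = of_int m / of_int n"
    using quotient_of_denom_pos[OF mn] quotient_of_div[OF mn] .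
  have "padic_abs (of_rat q :: 'p padic) * padic_abs (of_int n :: 'p padic)
      = padic_abs (of_int m :: 'p padic)"
    using n by (simp add: q of_rat_divide flip: padic_abs_mult)
  moreover have "padic_abs_rat CARD('p) q * padic_abs_rat CARD('p) (of_int n)
      = padic_abs_rat CARD('p) (of_int m)"
    using n by (simp add: q flip: padic_abs_rat_mult[OF p])
  moreover have "padic_abs_rat CARD('p) (of_int n) \<noteq> 0"
    using n by (simp add: p)
  ultimately show ?thesis unfolding int by (metis mult_right_cancel)
qed

instantiation padic :: (prime_card) metric_space
begin

definition dist_padic :: "'a padic \<Rightarrow> 'a padic \<Rightarrow> real"
  where "dist_padic x y = padic_abs (x - y)"

definition uniformity_padic :: "('a padic \<times> 'a padic) filter"
  where "uniformity_padic = (INF e\<in>{0<..}. principal {(x, y). dist x y < e})"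

definition open_padic :: "'a padic set \<Rightarrow> bool"
  where "open_padic U \<longleftrightarrow> (\<forall>x\<in>U. eventually (\<lambda>(x', y). x' = x \<longrightarrow> y \<in> U) uniformity)"

instance
proof
  fix x y z :: "'a padic"
  show "dist x y = 0 \<longleftrightarrow> x = y"
    by (simp add: dist_padic_def)
  have "padic_abs (x - y) \<le> max (padic_abs (x - z)) (padic_abs (y - z))"
    using padic_abs_add_le_max[of "x - z" "z - y"] padic_abs_minus_commute[of y z] by simp
  then show "dist x y \<le> dist x z + dist y z"
    unfolding dist_padic_def
    using padic_abs_nonneg[of "x - z"] padic_abs_nonneg[of "y - z"] by linarith
qed (rule uniformity_padic_def open_padic_def)+

end


section \<open>The dynamical system\<close>

text \<open>
  The function is only of interest on the complement of \<open>{- b / a}\<close>; at \<open>- b / a\<close> it has the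
  junk value \<open>0\<close>.
\<close>

definition cubic_map :: "'p::prime_card padic \<Rightarrow> 'p padic \<Rightarrow> 'p padic \<Rightarrow> 'p padic"
  where "cubic_map a b x = (x ^ 3 + a * x\<^sup>2 + b * x) / (a * x + b)"

definition padic_sphere :: "real \<Rightarrow> 'p::prime_card padic set"
  where "padic_sphere r = {x. padic_abs x = r}"

text \<open>
  With \<open>\<alpha> \<le> \<beta>\<close> the absolute values of the roots of \<open>x\<^sup>2 + a x + b\<close> and \<open>\<delta> = |a|\<close>,
  the first two branches are exhaustive: \<open>\<delta> \<le> \<alpha>\<close> if \<open>\<alpha> = \<beta>\<close>, and \<open>\<delta> = \<beta>\<close> if \<open>\<alpha> < \<beta>\<close>.
\<close>

definition radii_set :: "real \<Rightarrow> real \<Rightarrow> real \<Rightarrow> real set"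
  where "radii_set \<alpha> \<beta> \<delta> =
    (if \<delta> \<le> \<alpha> \<and> \<alpha> = \<beta> then {0<..<\<alpha>}
     else if \<alpha> < \<beta> \<and> \<beta> = \<delta> then {0<..<\<beta>} - {\<alpha>}
     else {})"

text \<open>
  The notion is only meant for self-maps of compact open sets, so these requirements are part
  of the predicate.
\<close>

definition uniformly_locally_isometric ::
    "'p::prime_card padic set \<Rightarrow> ('p padic \<Rightarrow> 'p padic) \<Rightarrow> bool"
  where "uniformly_locally_isometric X f \<longleftrightarrow>
    compact X \<and> open X \<and> f \<in> X \<rightarrow> X \<and>
    (\<exists>\<rho>>0. \<forall>c\<in>X. \<forall>x\<in>X. \<forall>y\<in>X.
       padic_abs (x - c) \<le> \<rho> \<longrightarrow> padic_abs (y - c) \<le> \<rho> \<longrightarrow>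
       padic_abs (f x - f y) = padic_abs (x - y))"

end

theory Submission
  imports Defs
begin

text \<open>
  Write \<open>f x = x + g x\<close> with \<open>g x = x\<^sup>3 / (a x + b)\<close>. As \<open>b\<close> is the product of the roots, the
  definition of \<open>A\<close> says exactly that \<open>|a| r \<noteq> |b|\<close> and \<open>r\<^sup>2 < M\<close> for \<open>M = max (|a| r) |b|\<close>.
  Hence \<open>|a x + b| = M\<close> on the sphere, and factoring \<open>x - y\<close> out of \<open>g x - g y\<close> gives
  \<open>|g x - g y| \<le> (r\<^sup>2 / M) |x - y|\<close>. So \<open>f\<close> is even an isometry of the whole sphere.
  Compactness of the sphere is completeness plus total boundedness of the \<open>p\<close>-adic numbers.
\<close>

section \<open>The ultrametric inequality\<close>

lemma padic_abs_diff_le_max: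
  "padic_abs (x - y :: 'p::prime_card padic) \<le> max (padic_abs x) (padic_abs y)"
  using padic_abs_add_le_max[of x "- y"] by simp

text \<open>Writing x as (x + y) - y, the strong triangle inequality bounds |x| by the maximum of |x
  + y| and |y|. As |y| < |x|, this leaves |x| \<le> |x + y|.\<close>

lemma padic_abs_add_eq_left:
  fixes x y :: "'p::prime_card padic"
  assumes "padic_abs y < padic_abs x"
  shows "padic_abs (x + y) = padic_abs x"
  using padic_abs_add_le_max[of x y] padic_abs_diff_le_max[of "x + y" y] assms by auto

lemma padic_abs_add_eq_max:
  fixes x y :: "'p::prime_card padic"
  assumes "padic_abs x \<noteq> padic_abs y"
  shows "padic_abs (x + y) = max (padic_abs x) (padic_abs y)"
proof (cases "padic_abs y < padic_abs x")
  case True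
  then show ?thesis using padic_abs_add_eq_left[of y x] by simp
next
  case False
  then show ?thesis using padic_abs_add_eq_left[of x y] assms by (simp add: add.commute)
qed

lemma padic_abs_power: "padic_abs (x ^ n :: 'p::prime_card padic) = padic_abs x ^ n"
  by (induction n) (simp_all add: padic_abs_mult)

lemma padic_abs_divide:
  "padic_abs (x / y :: 'p::prime_card padic) = padic_abs x / padic_abs y"
proof (cases "y = 0")
  case False
  then have "padic_abs (x / y) * padic_abs y = padic_abs x"
    by (simp flip: padic_abs_mult)
  with False show ?thesis by (simp add: eq_divide_eq)
qed simp

section \<open>Completeness\<close>

text \<open>The terms \<open>X n - q\<close> represent the difference, and the absolute value of a
  class is the limit along any representative. Constant sequences embed the rationals, so this
  computes distances to rational points.\<close>

lemma padic_abs_Padic_diff_const: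
  assumes "padic_Cauchy CARD('p) X"
  shows "(\<lambda>n. padic_abs_rat CARD('p) (X n - q))
    \<longlonglongrightarrow> padic_abs (Padic X - Padic (\<lambda>_. q) :: 'p::prime_card padic)"
proof -
  note p = prime_card[where 'a = 'p]
  have c: "padic_Cauchy CARD('p) (\<lambda>n. X n + - q)"
    by (intro padic_Cauchy_add p assms padic_Cauchy_const)
  have "(Padic X - Padic (\<lambda>_. q) :: 'p padic) = Padic (\<lambda>n. X n + - q)"
    unfolding minus_padic_def using assms
    by (simp add: uminus_padic.abs_eq plus_padic.abs_eq padic_rel_def p)
  then show ?thesis
    using padic_Cauchy_abs_tendsto[OF p c] c by (simp add: padic_abs.abs_eq padic_rel_def p)
qed

lemma dist_Padic_const:
  "dist (Padic (\<lambda>_. x)) (Padic (\<lambda>_. y) :: 'p::prime_card padic) = padic_abs_rat CARD('p) (x - y)"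
  using padic_abs_Padic_diff_const[of "\<lambda>_. x" y, where 'p = 'p] prime_card[where 'a = 'p]
  by (simp add: dist_padic_def LIMSEQ_const_iff)

lemma padic_rep:
  obtains X where "padic_Cauchy CARD('p) X" "x = (Padic X :: 'p::prime_card padic)"
  using Quotient_abs_rep[OF Quotient_padic, of x] Quotient_rep_reflp[OF Quotient_padic, of x]
  by (metis padic_rel_def)

text \<open>Beyond the Cauchy index of \<open>X\<close>, all later terms are uniformly close to
  \<open>X n\<close>, and this bound survives the passage to the limit.\<close>

lemma Padic_const_tendsto:
  assumes "padic_Cauchy CARD('p) X"
  shows "(\<lambda>n. Padic (\<lambda>_. X n)) \<longlonglongrightarrow> (Padic X :: 'p::prime_card padic)"
proof (rule metric_LIMSEQ_I)
  fix e :: real assume "e > 0"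
  then obtain k where k: "\<And>m n. m \<ge> k \<Longrightarrow> n \<ge> k \<Longrightarrow> padic_abs_rat CARD('p) (X m - X n) < e / 2"
    using padic_CauchyD[OF assms, of "e / 2"] by auto
  have "dist (Padic (\<lambda>_. X n)) (Padic X :: 'p padic) < e" if "n \<ge> k" for n
  proof -
    \<comment> \<open>A limit of values below \<open>e / 2\<close> is only weakly bounded by
      \<open>e / 2\<close>; the halving restores the strict inequality.\<close>
    have "padic_abs (Padic X - Padic (\<lambda>_. X n) :: 'p padic) \<le> e / 2"
      using k that
      by (intro tendsto_upperbound[OF padic_abs_Padic_diff_const[OF assms]])
         (auto simp: eventually_sequentially intro!: exI[of _ k] less_imp_le)
    then show ?thesis
      using \<open>e > 0\<close> by (simp add: dist_padic_def padic_abs_minus_commute)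
  qed
  then show "\<exists>k. \<forall>n\<ge>k. dist (Padic (\<lambda>_. X n)) (Padic X :: 'p padic) < e" by blast
qed

lemma padic_rat_dense:
  fixes x :: "'p::prime_card padic"
  assumes "e > 0"
  obtains q where "dist x (Padic (\<lambda>_. q)) < e"
proof -
  obtain X where X: "padic_Cauchy CARD('p) X" "x = Padic X" by (rule padic_rep)
  then obtain k where "\<forall>n\<ge>k. dist (Padic (\<lambda>_. X n)) x < e"
    using metric_LIMSEQ_D[OF Padic_const_tendsto[OF X(1)] assms] by blast
  then show ?thesis using that[of "X k"] by (auto simp: dist_commute)
qed

text \<open>Each \<open>X n\<close> is replaced by a rational \<open>q n\<close> at distance below
  1/(n+1). The sequence \<open>q\<close> is again Cauchy, so its class is a point of the space, and
  that point is the limit of both sequences.\<close>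

instance padic :: (prime_card) complete_space
proof
  fix X :: "nat \<Rightarrow> 'a padic"
  assume X: "Cauchy X"
  have "\<exists>q. dist (X n) (Padic (\<lambda>_. q)) < 1 / real (Suc n)" for n
    using padic_rat_dense[of "1 / real (Suc n)" "X n"] by auto
  then obtain q where q: "\<And>n. dist (X n) (Padic (\<lambda>_. q n)) < 1 / real (Suc n)"
    by metis
  have d0: "(\<lambda>n. dist (X n) (Padic (\<lambda>_. q n))) \<longlonglongrightarrow> 0"
    by (rule tendsto_sandwich[OF _ _ tendsto_const LIMSEQ_inverse_real_of_nat])
       (use q in \<open>auto simp: inverse_eq_divide intro!: always_eventually less_imp_le\<close>)
  have "padic_Cauchy CARD('a) q"
    unfolding padic_Cauchy_def dist_Padic_const[symmetric]
  proof (intro allI impI)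
    fix e :: real assume e: "e > 0"
    obtain i where i: "\<And>m n. m \<ge> i \<Longrightarrow> n \<ge> i \<Longrightarrow> dist (X m) (X n) < e / 3"
      using metric_CauchyD[OF X, of "e / 3"] e by auto
    obtain j where j: "\<And>n. n \<ge> j \<Longrightarrow> dist (X n) (Padic (\<lambda>_. q n)) < e / 3"
      using order_tendstoD(2)[OF d0, of "e / 3"] e by (auto simp: eventually_sequentially)
    have "dist (Padic (\<lambda>_. q m)) (Padic (\<lambda>_. q n) :: 'a padic) < e"
      if "m \<ge> max i j" "n \<ge> max i j" for m n
    proof -
      have "dist (X m) (X n) < e / 3" "dist (X m) (Padic (\<lambda>_. q m)) < e / 3"
        "dist (X n) (Padic (\<lambda>_. q n)) < e / 3"
        using i j that by simp_all
      then show ?thesis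
        using dist_triangle3[of "Padic (\<lambda>_. q m)" "Padic (\<lambda>_. q n)" "X m"]
          dist_triangle[of "X m" "Padic (\<lambda>_. q n)" "X n"]
        by linarith
    qed
    then show "\<exists>k. \<forall>m\<ge>k. \<forall>n\<ge>k. dist (Padic (\<lambda>_. q m)) (Padic (\<lambda>_. q n) :: 'a padic) < e"
      by blast
  qed
  from Padic_const_tendsto[OF this] obtain L :: "'a padic"
    where L: "(\<lambda>n. Padic (\<lambda>_. q n)) \<longlonglongrightarrow> L" by blast
  have "X \<longlonglongrightarrow> L"
    unfolding tendsto_dist_iff[of X]
  proof (rule tendsto_sandwich[OF _ _ tendsto_const])
    show "(\<lambda>n. dist (X n) (Padic (\<lambda>_. q n)) + dist (Padic (\<lambda>_. q n)) L) \<longlonglongrightarrow> 0"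
      using tendsto_add[OF d0] L by (simp add: tendsto_dist_iff[of "\<lambda>n. Padic (\<lambda>_. q n)"])
  qed (auto intro: dist_triangle always_eventually)
  then show "convergent X" by (rule convergentI)
qed

section \<open>Total boundedness\<close>

text \<open>In lowest terms, a denominator divisible by p forces a numerator prime to p, and then
  the absolute value exceeds 1.\<close>

lemma padic_abs_rat_le_oneE:
  assumes p: "prime p" and q: "padic_abs_rat p q \<le> 1"
  obtains u v where "q = of_int u / of_int v" "v \<noteq> 0" "\<not> int p dvd v"
proof (cases "q = 0")
  case True
  then show ?thesis using that[of 0 1] prime_gt_1_nat[OF p] by simp
next
  case False
  obtain m n where mn: "quotient_of q = (m, n)" by fastforce
  note n = quotient_of_denom_pos[OF mn] and qe = quotient_of_div[OF mn]
    and co = quotient_of_coprime[OF mn]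
  have "m \<noteq> 0" using False qe by auto
  have "\<not> int p dvd n"
  proof
    assume d: "int p dvd n"
    then have "\<not> int p dvd m"
      using co p by (metis coprime_common_divisor not_prime_unit prime_nat_int_transfer)
    then have "multiplicity (int p) m = 0" by (rule not_dvd_imp_multiplicity_0)
    moreover have "multiplicity (int p) n > 0"
      using d n p by (simp add: prime_multiplicity_gt_zero_iff)
    ultimately have "padic_abs_rat p q > 1"
      using False mn prime_gt_1_nat[OF p]
      by (simp add: padic_abs_rat_def one_less_power)
    with q show False by simp
  qed
  then show ?thesis using that[of m n] qe n by simp
qed

lemma padic_abs_rat_le_power:
  assumes p: "prime p" and "int p ^ N dvd u" and "\<not> int p dvd v" "v \<noteq> 0"
  shows "padic_abs_rat p (of_int u / of_int v) \<le> 1 / real p ^ N"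
proof (cases "u = 0")
  \<comment> \<open>Since \<open>multiplicity\<close> assigns 0 to the number 0, the valuation
    argument below cannot cover this case.\<close>
  case True
  then show ?thesis by (simp add: p)
next
  case False
  have "N \<le> multiplicity (int p) u"
    using assms False p not_prime_unit[of "int p"] by (intro multiplicity_geI) auto
  moreover have "multiplicity (int p) v = 0"
    using assms by (intro not_dvd_imp_multiplicity_0)
  ultimately have "padic_abs_rat p (of_int u / of_int v) \<le> real p powi (- int N)"
    unfolding padic_abs_rat_fract[OF p False \<open>v \<noteq> 0\<close>]
    using prime_ge_1_nat[OF p] by (intro power_int_increasing) auto
  then show ?thesis by (simp add: power_int_minus divide_inverse)
qed

text \<open>A denominator prime to p is invertible modulo p^N, so q has a residue there. These
  residues form the finite net behind total boundedness.\<close>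

lemma padic_integral_rat_residue:
  assumes p: "prime p" and q: "padic_abs_rat p q \<le> 1"
  obtains c where "c \<in> {0..<int p ^ N}" "padic_abs_rat p (q - of_int c) \<le> 1 / real p ^ N"
proof -
  obtain u v where uv: "q = of_int u / of_int v" "v \<noteq> 0" "\<not> int p dvd v"
    using padic_abs_rat_le_oneE[OF p q] .
  have "coprime v (int p ^ N)"
    using prime_imp_coprime[of "int p" v] uv(3) p by (simp add: coprime_commute)
  then obtain w z where wz: "w * v + z * int p ^ N = 1"
    using bezout_int[of v "int p ^ N"] by auto
  \<comment> \<open>By the Bezout identity \<open>w\<close> inverts \<open>v\<close> modulo p^N, so
    \<open>c\<close> is the residue of u/v, and p^N divides the numerator \<open>u - c * v\<close>
    of q - c.\<close>
  define c where "c = (u * w) mod int p ^ N"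
  have "u - c * v = u - u * w * v + (u * w) div int p ^ N * int p ^ N * v"
    by (simp add: c_def algebra_simps flip: minus_div_mult_eq_mod)
  also have "u - u * w * v = u * z * int p ^ N"
    using arg_cong[OF wz, of "(*) u"] by (simp add: algebra_simps)
  finally have "int p ^ N dvd u - c * v" by simp
  from padic_abs_rat_le_power[OF p this uv(3,2)]
  have "padic_abs_rat p (q - of_int c) \<le> 1 / real p ^ N"
    using uv by (simp add: diff_divide_distrib)
  moreover have "c \<in> {0..<int p ^ N}"
    using prime_gt_0_nat[OF p] by (simp add: c_def)
  ultimately show ?thesis using that by blast
qed

lemma padic_abs_rat_prime_power:
  assumes p: "prime p"
  shows "padic_abs_rat p (of_nat p ^ k) = 1 / real p ^ k"
proof -
  have "multiplicity (int p) (int p ^ k) = k"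
    using p not_prime_unit[of "int p"] by (intro multiplicity_same_power) auto
  then show ?thesis
    using padic_abs_rat_fract[OF p, of "int p ^ k" 1] prime_gt_0_nat[OF p]
    by (simp add: power_int_minus divide_inverse)
qed

text \<open>With R < p^k, multiplication by p^k moves rational approximations into the p-integral
  numbers, where residues modulo p^(k+m) approximate up to p^-(k+m). Scaling back multiplies the
  error by p^k and leaves p^-m < e.\<close>

lemma padic_totally_bounded:
  fixes R e :: real
  assumes e: "e > 0"
  shows "\<exists>K. finite K \<and> {x :: 'p::prime_card padic. padic_abs x \<le> R} \<subseteq> (\<Union>c\<in>K. ball c e)"
proof -
  let ?p = "CARD('p)"
  note p = prime_card[where 'a = 'p]
  have p1: "real ?p > 1" using prime_gt_1_nat[OF p] by simp
  obtain k where k: "R < real ?p ^ k" using real_arch_pow[OF p1] by blast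
  obtain m where "1 / e < real ?p ^ m" using real_arch_pow[OF p1] by blast
  then have m: "1 / real ?p ^ m < e" using e p1 by (simp add: field_simps)
  define \<iota> :: "rat \<Rightarrow> 'p padic" where "\<iota> q = Padic (\<lambda>_. q)" for q
  have \<iota>: "dist (\<iota> x) (\<iota> y) = padic_abs_rat ?p (x - y)" for x y
    unfolding \<iota>_def by (rule dist_Padic_const)
  define K where "K = (\<lambda>c. \<iota> (of_int c / of_nat ?p ^ k)) ` {0..<int ?p ^ (k + m)}"
  have "\<exists>c\<in>K. dist c x < e" if x: "padic_abs x \<le> R" for x :: "'p padic"
  proof -
    \<comment> \<open>Closeness within \<open>e\<close> serves the covering; closeness within p^k
      ensures that |q| \<le> p^k, so that p^k q is p-integral.\<close>
    have "min e (real ?p ^ k) > 0" using e p1 by simp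
    from padic_rat_dense[OF this, of x]
    obtain q where q: "dist x (\<iota> q) < e" "dist x (\<iota> q) < real ?p ^ k"
      unfolding \<iota>_def by auto
    have "\<iota> 0 = 0" by (simp add: \<iota>_def zero_padic_def)
    then have "padic_abs_rat ?p q = padic_abs (\<iota> q)"
      using \<iota>[of q 0] by (simp add: dist_padic_def)
    also have "\<dots> \<le> max (padic_abs x) (padic_abs (x - \<iota> q))"
      using padic_abs_diff_le_max[of x "x - \<iota> q"] by simp
    also have "\<dots> \<le> real ?p ^ k"
      using x k q by (simp add: dist_padic_def)
    finally have "padic_abs_rat ?p (of_nat ?p ^ k * q) \<le> 1"
      using p1 by (simp add: padic_abs_rat_mult[OF p] padic_abs_rat_prime_power[OF p]
          divide_le_eq_1)
    then obtain c where c: "c \<in> {0..<int ?p ^ (k + m)}"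
      "padic_abs_rat ?p (of_nat ?p ^ k * q - of_int c) \<le> 1 / real ?p ^ (k + m)"
      by (rule padic_integral_rat_residue[OF p])
    have "of_nat ?p ^ k * q - of_int c = of_nat ?p ^ k * (q - of_int c / of_nat ?p ^ k)"
      using p1 by (simp add: right_diff_distrib)
    then have "1 / real ?p ^ k * padic_abs_rat ?p (q - of_int c / of_nat ?p ^ k)
        \<le> 1 / real ?p ^ (k + m)"
      using c(2) by (simp only: padic_abs_rat_mult[OF p] padic_abs_rat_prime_power[OF p])
    then have "padic_abs_rat ?p (q - of_int c / of_nat ?p ^ k) \<le> 1 / real ?p ^ m"
      using p1 by (simp add: field_simps power_add)
    then have "dist (\<iota> q) (\<iota> (of_int c / of_nat ?p ^ k)) < e"
      unfolding \<iota> using m by simp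
    \<comment> \<open>In an ultrametric two errors below \<open>e\<close> combine to one below
      \<open>e\<close>, so \<open>e\<close> need not be split.\<close>
    moreover have "dist x y < e" if "dist (\<iota> q) y < e" for y
      using that q padic_abs_add_le_max[of "x - \<iota> q" "\<iota> q - y"] by (simp add: dist_padic_def)
    ultimately have "dist x (\<iota> (of_int c / of_nat ?p ^ k)) < e" by blast
    then show ?thesis using c(1) by (auto simp: K_def dist_commute)
  qed
  then have "{x. padic_abs x \<le> R} \<subseteq> (\<Union>c\<in>K. ball c e)" by auto
  moreover have "finite K" by (simp add: K_def)
  ultimately show ?thesis by blast
qed

section \<open>Spheres\<close>

text \<open>Gives access to the closedness of metric spheres, which follows from continuity of
  \<open>dist\<close>.\<close>

lemma padic_sphere_eq: "padic_sphere r = sphere (0 :: 'p::prime_card padic) r"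
  by (auto simp: padic_sphere_def dist_padic_def)

lemma compact_padic_sphere: "compact (padic_sphere r :: 'p::prime_card padic set)"
  unfolding compact_eq_totally_bounded
proof (intro conjI allI impI)
  show "complete (padic_sphere r :: 'p padic set)"
    by (simp add: complete_eq_closed padic_sphere_eq sphere_def closed_Collect_eq continuous_intros)
  show "\<exists>K. finite K \<and> (padic_sphere r :: 'p padic set) \<subseteq> (\<Union>c\<in>K. ball c e)" if "e > 0" for e
    using padic_totally_bounded[OF that, of r, where 'p = 'p] by (force simp: padic_sphere_def)
qed

text \<open>A perturbation y - x smaller than |x| = r does not change the absolute value, so the
  sphere contains the ball of radius r around each of its points.\<close>

lemma open_padic_sphere:
  assumes "r > 0"
  shows "open (padic_sphere r :: 'p::prime_card padic set)"
  unfolding open_dist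
proof (intro ballI exI[of _ r] conjI allI impI)
  fix x y :: "'p padic"
  assume "x \<in> padic_sphere r" "dist y x < r"
  then show "y \<in> padic_sphere r"
    using padic_abs_add_eq_left[of "y - x" x] by (simp add: padic_sphere_def dist_padic_def)
qed (rule assms)

section \<open>The cubic map\<close>

lemma cubic_map_eq_add:
  fixes a b x :: "'p::prime_card padic"
  assumes "a * x + b \<noteq> 0"
  shows "cubic_map a b x = x + x ^ 3 / (a * x + b)"
  using assms by (simp add: cubic_map_def field_simps power2_eq_square)

text \<open>Hypothesis \<open>ne\<close> excludes cancellation in the denominator, and
  \<open>less\<close> makes the cubic correction strictly smaller than the identity part, both for
  values and for differences.\<close>

lemma cubic_map_isometry_on_sphere:
  fixes a b :: "'p::prime_card padic"
  assumes r: "r > 0" and ne: "padic_abs a * r \<noteq> padic_abs b"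
    and less: "r\<^sup>2 < max (padic_abs a * r) (padic_abs b)"
  shows "cubic_map a b \<in> padic_sphere r \<rightarrow> padic_sphere r"
    and "\<And>x y. x \<in> padic_sphere r \<Longrightarrow> y \<in> padic_sphere r \<Longrightarrow>
      padic_abs (cubic_map a b x - cubic_map a b y) = padic_abs (x - y)"
proof -
  define M where "M = max (padic_abs a * r) (padic_abs b)"
  have M: "M > 0" "r\<^sup>2 < M" using less zero_le_power2[of r] unfolding M_def by linarith+
  have den: "padic_abs (a * x + b) = M" if "x \<in> padic_sphere r" for x
    using that ne padic_abs_add_eq_max[of "a * x" b]
    by (simp add: padic_sphere_def padic_abs_mult M_def)
  have nz: "a * x + b \<noteq> 0" if "x \<in> padic_sphere r" for x
    using den[OF that] M by auto
  show "cubic_map a b \<in> padic_sphere r \<rightarrow> padic_sphere r"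
  proof
    fix x :: "'p padic" assume x: "x \<in> padic_sphere r"
    then have xr: "padic_abs x = r" by (simp add: padic_sphere_def)
    have "padic_abs (x ^ 3 / (a * x + b)) = r * (r\<^sup>2 / M)"
      using den[OF x] xr by (simp add: padic_abs_divide padic_abs_power
          power3_eq_cube[of r] power2_eq_square)
    also have "\<dots> < r" using r M by (simp add: divide_less_eq)
    finally show "cubic_map a b x \<in> padic_sphere r"
      using padic_abs_add_eq_left[of "x ^ 3 / (a * x + b)" x] xr
      by (simp add: cubic_map_eq_add[OF nz[OF x]] padic_sphere_def)
  qed
  fix x y :: "'p padic"
  assume x: "x \<in> padic_sphere r" and y: "y \<in> padic_sphere r"
  have xr: "padic_abs x = r" and yr: "padic_abs y = r" using x y by (simp_all add: padic_sphere_def)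
  \<comment> \<open>Cross-multiplying gives x^3 (a y + b) - y^3 (a x + b) = a x y (x^2 - y^2) + b
    (x^3 - y^3); \<open>t\<close> is the cofactor of x - y.\<close>
  define t where "t = a * (x * y * (x + y)) + b * (x\<^sup>2 + x * y + y\<^sup>2)"
  define h where "h = x ^ 3 / (a * x + b) - y ^ 3 / (a * y + b)"
  have h: "h = (x - y) * t / ((a * x + b) * (a * y + b))"
    using nz[OF x] nz[OF y]
    by (simp add: h_def t_def diff_frac_eq) (simp add: algebra_simps power2_eq_square power3_eq_cube)
  \<comment> \<open>Both summands of \<open>t\<close> are at most M r^2: the first because |a| r
    \<le> M, the second because |b| \<le> M.\<close>
  have "padic_abs (x + y) \<le> r"
    using padic_abs_add_le_max[of x y] xr yr by simp
  then have "padic_abs (a * (x * y * (x + y))) \<le> padic_abs a * (r * r * r)"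
    using r by (simp add: padic_abs_mult xr yr mult_left_mono)
  also have "\<dots> = padic_abs a * r * r\<^sup>2" by (simp add: power2_eq_square)
  also have "\<dots> \<le> M * r\<^sup>2" by (intro mult_right_mono) (simp_all add: M_def)
  finally have t1: "padic_abs (a * (x * y * (x + y))) \<le> M * r\<^sup>2" .
  have "padic_abs (x\<^sup>2 + x * y + y\<^sup>2) \<le> max (max (padic_abs (x\<^sup>2)) (padic_abs (x * y))) (padic_abs (y\<^sup>2))"
    by (meson max.mono order_refl order_trans padic_abs_add_le_max)
  then have "padic_abs (x\<^sup>2 + x * y + y\<^sup>2) \<le> r\<^sup>2"
    by (simp add: padic_abs_power padic_abs_mult xr yr power2_eq_square)
  then have "padic_abs (b * (x\<^sup>2 + x * y + y\<^sup>2)) \<le> M * r\<^sup>2"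
    unfolding padic_abs_mult using M by (intro mult_mono) (simp_all add: M_def)
  with t1 have t: "padic_abs t \<le> M * r\<^sup>2"
    unfolding t_def using padic_abs_add_le_max[of "a * (x * y * (x + y))" "b * (x\<^sup>2 + x * y + y\<^sup>2)"]
    by simp
  show "padic_abs (cubic_map a b x - cubic_map a b y) = padic_abs (x - y)"
  \<comment> \<open>The strict comparison of |h| with |x - y| requires |x - y| > 0.\<close>
  proof (cases "x = y")
    case False
    have "padic_abs h = padic_abs (x - y) * padic_abs t / (M * M)"
      by (simp add: h padic_abs_divide padic_abs_mult den x y)
    also have "\<dots> \<le> padic_abs (x - y) * (M * r\<^sup>2) / (M * M)"
      using t M by (intro divide_right_mono mult_left_mono) auto
    also have "\<dots> = padic_abs (x - y) * (r\<^sup>2 / M)" using M by simp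
    also have "\<dots> < padic_abs (x - y) * 1"
    proof (rule mult_strict_left_mono)
      show "padic_abs (x - y) > 0"
        using False padic_abs_nonneg[of "x - y"] by (simp add: less_le)
    qed (use M in simp)
    finally have "padic_abs (x - y + h) = padic_abs (x - y)"
      by (intro padic_abs_add_eq_left) simp
    moreover have "cubic_map a b x - cubic_map a b y = x - y + h"
      by (simp add: h_def cubic_map_eq_add nz x y)
    ultimately show ?thesis by simp
  qed simp
qed

section \<open>From the set of radii to the conditions on |a| r and |b|\<close>

theorem corollary2:
  fixes a b s x\<^sub>1 x\<^sub>2 :: "'p::prime_card padic" and \<alpha> \<beta> \<delta> r :: real
  assumes "a * b \<noteq> 0"
    and "s\<^sup>2 = a\<^sup>2 - 4 * b"
    and "x\<^sub>1 = (- a + s) / 2 \<and> x\<^sub>2 = (- a - s) / 2 \<or> x\<^sub>1 = (- a - s) / 2 \<and> x\<^sub>2 = (- a + s) / 2"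
    and "\<alpha> = padic_abs x\<^sub>1" and "\<beta> = padic_abs x\<^sub>2" and "\<alpha> \<le> \<beta>"
    and "\<delta> = padic_abs a"
    and "r \<in> radii_set \<alpha> \<beta> \<delta>"
  shows "- b / a \<notin> padic_sphere r \<and>
         uniformly_locally_isometric (padic_sphere r) (cubic_map a b)"
proof -
  \<comment> \<open>Vieta's formula for the constant term; it expresses |b| through \<alpha> and
    \<beta>.\<close>
  have "b = x\<^sub>1 * x\<^sub>2"
  proof -
    have "(- a + s) / 2 * ((- a - s) / 2) = (a\<^sup>2 - s\<^sup>2) / 4"
      by (simp add: field_simps power2_eq_square)
    also have "\<dots> = b" using assms(2) by simp
    finally show ?thesis using assms(3) by (metis mult.commute)
  qed
  then have b: "padic_abs b = \<alpha> * \<beta>" using assms by (simp add: padic_abs_mult)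
  consider (equal) "\<delta> \<le> \<alpha>" "\<alpha> = \<beta>" "0 < r" "r < \<alpha>"
    | (distinct) "\<alpha> < \<beta>" "\<beta> = \<delta>" "0 < r" "r < \<beta>" "r \<noteq> \<alpha>"
    using assms(8) by (auto simp: radii_set_def split: if_splits)
  then have r: "0 < r" "\<delta> * r \<noteq> \<alpha> * \<beta>" "r\<^sup>2 < max (\<delta> * r) (\<alpha> * \<beta>)"
  proof (atomize (full), cases)
    case equal
    \<comment> \<open>Here \<alpha> \<beta> = \<alpha>^2 is the maximum, strictly above both
      \<delta> r and r^2.\<close>
    have "\<delta> * r \<le> \<alpha> * r" using equal by (intro mult_right_mono) auto
    also have "\<dots> < \<alpha> * \<alpha>" using equal by (intro mult_strict_left_mono) auto
    finally have "\<delta> * r < \<alpha> * \<alpha>" .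
    moreover have "r * r < \<alpha> * \<alpha>" using equal by (intro mult_strict_mono) auto
    ultimately show "0 < r \<and> \<delta> * r \<noteq> \<alpha> * \<beta> \<and> r\<^sup>2 < max (\<delta> * r) (\<alpha> * \<beta>)"
      using equal by (simp add: power2_eq_square)
  next
    case distinct
    \<comment> \<open>Here \<delta> = \<beta>: from r \<noteq> \<alpha> follows \<delta> r \<noteq>
      \<alpha> \<beta>, and r < \<beta> gives r^2 < \<delta> r, whichever of the two is the
      maximum.\<close>
    have "r * r < \<beta> * r" using distinct by (intro mult_strict_right_mono) auto
    then show "0 < r \<and> \<delta> * r \<noteq> \<alpha> * \<beta> \<and> r\<^sup>2 < max (\<delta> * r) (\<alpha> * \<beta>)"
      using distinct by (simp add: power2_eq_square less_max_iff_disj)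
  qed
  \<comment> \<open>The pole has absolute value \<alpha> \<beta> / \<delta>, which differs from r by
    the second fact in \<open>r\<close>.\<close>
  have "- b / a \<notin> padic_sphere r"
    using r(2) assms(1,7) by (auto simp: padic_sphere_def padic_abs_divide b)
  moreover have "uniformly_locally_isometric (padic_sphere r) (cubic_map a b)"
    unfolding uniformly_locally_isometric_def
    using compact_padic_sphere open_padic_sphere[OF r(1)] r b assms(7)
      cubic_map_isometry_on_sphere[of r a b]
    \<comment> \<open>The radius 1 is an arbitrary positive choice, as the map is isometric on the
      whole sphere.\<close>
    by (intro conjI exI[of _ 1]) auto
  ultimately show ?thesis ..
qed

end
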